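(* Let $p$ be an odd prime and let $\{x_1,\ldots,x_n\}\subset \mathbb{F}_p^2\setminus\{(0,0)\}$ be a set of vectors spanning all $p+1$ nonzero directions from $0$ in $\mathbb{F}_p^2$, i.e. for every line $\ell$ through the origin in $\mathbb{F}_p^2$ (every set $\{(x,y): ax+by=0\}$ with $(a,b)\neq(0,0)$) some $x_i$ lies on $\ell$. Then there exists a nonempty subset $I\subset\{1,\ldots,n\}$ such that $\sum_{i\in I} x_i = 0$.
   Context: Two vectors $(a,b),(c,d)\in\mathbb{F}_p^2$ have the same direction from zero if $(a,b)=(tc,td)$ for some $t\in\mathbb{F}_p\setminus\{0\}$; there are exactly $p+1$ nonzero directions. *)

theory Defs
  imports "Berlekamp_Zassenhaus.Finite_Field" "HOL-Library.Product_Plus"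
begin

text \<open>
  The field with \<open>p\<close> elements is \<^typ>\<open>'p::prime_card mod_ring\<close>, where \<open>p = CARD('p)\<close>; the class
  \<^class>\<open>prime_card\<close> makes \<open>p\<close> prime. The plane over it is the product type with
  componentwise addition.
\<close>

definition origin_lines :: "('a::comm_ring_1 \<times> 'a) set set" where
  "origin_lines = {{(u, v). a * u + b * v = 0} | a b. (a, b) \<noteq> (0, 0)}"

definition spans_all_directions :: "('a::comm_ring_1 \<times> 'a) set \<Rightarrow> bool" where
  "spans_all_directions X \<longleftrightarrow> (\<forall>l\<in>origin_lines. \<exists>x\<in>X. x \<in> l)"

end

theory Submission
  imports Defs Complex_Main
begin

text \<open>
  Let \<open>\<chi>\<close> be a nontrivial additive character of \<open>\<F>\<^sub>p\<close> and consider
  \<open>S = (\<Sum>v. \<Prod>i. 1 - \<chi> (v \<bullet> x\<^sub>i))\<close>, with \<open>v\<close> ranging over the whole plane. Each \<open>v\<close> is orthogonal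
  to some \<open>x\<^sub>i\<close>, because the line orthogonal to \<open>v\<close> contains one; so every product has a zero factor
  and \<open>S = 0\<close>. Expanding the products, orthogonality of characters gives
  \<open>S = p\<^sup>2 \<cdot> (\<Sum>I. (-1) ^ card I)\<close>, with \<open>I\<close> ranging over the index sets of zero sum. The empty set
  alone would contribute \<open>p\<^sup>2 \<noteq> 0\<close>, so there is another one.
\<close>

definition additive_char :: "'p::prime_card mod_ring \<Rightarrow> complex" where
  "additive_char u = cis (2 * pi * (real_of_int (to_int_mod_ring u) / real CARD('p)))"

text \<open>The two angles differ by \<open>k div m\<close> full turns. Adding residues reduces the
  integer sum modulo p; this removes that reduction from the angle, which makes
  \<open>additive_char\<close> additive.\<close>

lemma cis_mod_period:
  fixes k m :: int
  assumes "m > 0"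
  shows "cis (2 * pi * (real_of_int (k mod m) / real_of_int m)) = cis (2 * pi * (real_of_int k / real_of_int m))"
proof -
  have "real_of_int k = real_of_int m * real_of_int (k div m) + real_of_int (k mod m)"
    by (metis mult_div_mod_eq of_int_add of_int_mult)
  then have "2 * pi * (real_of_int k / real_of_int m)
      = 2 * pi * real_of_int (k div m) + 2 * pi * (real_of_int (k mod m) / real_of_int m)"
    using assms by (simp add: field_simps)
  then show ?thesis
    by (simp only: cis_mult [symmetric] cis_multiple_2pi Ints_of_int mult_1_left)
qed

lemma additive_char_add: "additive_char (a + b) = additive_char a * additive_char b"
  for a b :: "'p::prime_card mod_ring"
proof -
  have "additive_char (a + b)
      = cis (2 * pi * (real_of_int (to_int_mod_ring a + to_int_mod_ring b) / real CARD('p)))"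
    using cis_mod_period[of "int CARD('p)" "to_int_mod_ring a + to_int_mod_ring b"]
    unfolding additive_char_def to_int_mod_ring_add by simp
  then show ?thesis
    by (simp only: additive_char_def cis_mult of_int_add add_divide_distrib distrib_left)
qed

lemma additive_char_0 [simp]: "additive_char 0 = 1"
  by (simp add: additive_char_def)

lemma additive_char_sum: "additive_char (\<Sum>i\<in>I. f i) = (\<Prod>i\<in>I. additive_char (f i))"
  by (induction I rule: infinite_finite_induct) (auto simp: additive_char_add)

text \<open>Otherwise 1/p would be an integer, forcing p = 1.\<close>

lemma additive_char_1_neq_1: "additive_char (1 :: 'p::prime_card mod_ring) \<noteq> 1"
proof
  assume "additive_char (1 :: 'p mod_ring) = 1"
  then have "cos (2 * pi * (1 / real CARD('p))) = 1"
    by (simp add: additive_char_def complex_eq_iff)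
  then obtain k :: int where "2 * pi * (1 / real CARD('p)) = k * 2 * pi"
    by (auto simp: cos_one_2pi_int)
  then have "real_of_int (k * int CARD('p)) = real_of_int 1"
    by (simp add: field_simps)
  then have "k * int CARD('p) = 1"
    by (simp only: of_int_eq_iff)
  then have "int CARD('p) = 1"
    using zmult_eq_1_iff[of k "int CARD('p)"] by linarith
  then show False
    using nontriv[where ?'a = 'p] by simp
qed

definition dot :: "'a::comm_ring_1 \<times> 'a \<Rightarrow> 'a \<times> 'a \<Rightarrow> 'a" where
  "dot v w = fst v * fst w + snd v * snd w"

lemma dot_add_left: "dot (v + v') w = dot v w + dot v' w"
  by (simp add: dot_def algebra_simps)

lemma dot_zero_right [simp]: "dot v 0 = 0"
  by (simp add: dot_def)

lemma dot_sum_right: "dot v (\<Sum>i\<in>I. x i) = (\<Sum>i\<in>I. dot v (x i))"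
  by (simp add: dot_def fst_sum snd_sum sum_distrib_left sum.distrib)

lemma dot_surj:
  fixes w :: "'a::field \<times> 'a"
  assumes "w \<noteq> 0"
  obtains v where "dot v w = c"
proof (cases "fst w = 0")
  case True
  then have "dot (0, c / snd w) w = c"
    using assms by (cases w) (auto simp: dot_def zero_prod_def)
  then show thesis ..
next
  case False
  then have "dot (c / fst w, 0) w = c"
    by (simp add: dot_def)
  then show thesis ..
qed

text \<open>Translating by a \<open>v\<^sub>0\<close> with \<open>dot v\<^sub>0 w = 1\<close>
  permutes the terms, yet multiplies the sum by \<open>additive_char 1\<close>, which is not
  1.\<close>

lemma sum_additive_char_dot_eq_0:
  fixes w :: "'p::prime_card mod_ring \<times> 'p mod_ring"
  assumes "w \<noteq> 0"
  shows "(\<Sum>v\<in>UNIV. additive_char (dot v w)) = 0"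
proof -
  obtain v\<^sub>0 where v\<^sub>0: "dot v\<^sub>0 w = 1"
    using dot_surj[OF assms] .
  have "(\<Sum>v\<in>UNIV. additive_char (dot v w)) = (\<Sum>v\<in>UNIV. additive_char (dot (v\<^sub>0 + v) w))"
    by (rule sum.reindex_bij_witness[of _ "\<lambda>v. v\<^sub>0 + v" "\<lambda>v. v - v\<^sub>0"]) auto
  also have "\<dots> = additive_char (1 :: 'p mod_ring) * (\<Sum>v\<in>UNIV. additive_char (dot v w))"
    by (simp add: dot_add_left additive_char_add v\<^sub>0 sum_distrib_left)
  finally show ?thesis
    using additive_char_1_neq_1[where ?'p = 'p] by simp
qed

text \<open>For nonzero \<open>v\<close>, the vectors orthogonal to \<open>v\<close> form an origin
  line whose coefficients are the coordinates of \<open>v\<close>.\<close>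

lemma spans_all_directions_orthogonal:
  fixes X :: "('a::comm_ring_1 \<times> 'a) set"
  assumes "spans_all_directions X"
  shows "\<exists>x\<in>X. dot v x = 0"
proof -
  have meets: "\<exists>x\<in>X. dot v x = 0" if "v \<noteq> 0" for v
  proof -
    have "(fst v, snd v) \<noteq> (0, 0)"
      using that by (simp add: zero_prod_def)
    then have "{(s, t). fst v * s + snd v * t = 0} \<in> origin_lines"
      unfolding origin_lines_def by blast
    with assms obtain x where "x \<in> X" "x \<in> {(s, t). fst v * s + snd v * t = 0}"
      unfolding spans_all_directions_def by blast
    then show ?thesis
      by (intro bexI[of _ x]) (auto simp: dot_def)
  qed
  show ?thesis
  proof (cases "v = 0")
    case True
    \<comment> \<open>Every vector is orthogonal to 0, so any point of \<open>X\<close> will do; the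
      arbitrary nonzero vector (1, 0) shows that there is one.\<close>
    obtain x where "x \<in> X"
      using meets[of "(1, 0)"] by (auto simp: zero_prod_def)
    then show ?thesis
      using True by (intro bexI[of _ x]) (simp_all add: dot_def)
  qed (use meets in blast)
qed

theorem theorem1:
  fixes x :: "nat \<Rightarrow> 'p::prime_card mod_ring \<times> 'p mod_ring"
    and n :: nat
  assumes "odd CARD('p)"
    and "x ` {1..n} \<subseteq> UNIV - {(0, 0)}"
    and "spans_all_directions (x ` {1..n})"
  shows "\<exists>I. I \<subseteq> {1..n} \<and> I \<noteq> {} \<and> (\<Sum>i\<in>I. x i) = 0"
proof (rule ccontr)
  assume "\<not> ?thesis"
  then have nonzero: "(\<Sum>i\<in>I. x i) \<noteq> 0" if "I \<in> Pow {1..n} - {{}}" for I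
    using that by blast
  let ?e = "\<lambda>v w. additive_char (dot v w)"
  let ?T = "\<lambda>I. (-1) ^ card I * (\<Sum>v\<in>UNIV. ?e v (\<Sum>i\<in>I. x i))"
  have vanish: "(\<Prod>i\<in>{1..n}. 1 - ?e v (x i)) = 0" for v
  proof -
    obtain i where "i \<in> {1..n}" "dot v (x i) = 0"
      using spans_all_directions_orthogonal[OF assms(3), of v] by blast
    then show ?thesis
      by (intro prod_zero) (auto intro!: bexI[of _ i])
  qed
  have "0 = (\<Sum>v\<in>UNIV. \<Prod>i\<in>{1..n}. 1 - ?e v (x i))"
    by (simp only: vanish sum.neutral_const)
  \<comment> \<open>\<open>I\<close> collects the factors contributing their character term; these
    characters multiply to the character of the subset sum.\<close>
  also have "\<dots> = (\<Sum>v\<in>UNIV. \<Sum>I\<in>Pow {1..n}. (-1) ^ card I * ?e v (\<Sum>i\<in>I. x i))"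
    by (simp add: prod_diff_conv_sum dot_sum_right additive_char_sum)
  also have "\<dots> = (\<Sum>I\<in>Pow {1..n}. ?T I)"
    by (subst sum.swap) (simp add: sum_distrib_left)
  also have "\<dots> = ?T {} + (\<Sum>I\<in>Pow {1..n} - {{}}. ?T I)"
    by (rule sum.remove) auto
  also have "(\<Sum>I\<in>Pow {1..n} - {{}}. ?T I) = 0"
    using nonzero by (intro sum.neutral ballI) (simp add: sum_additive_char_dot_eq_0)
  \<comment> \<open>What remains is 0 = \<open>?T {}\<close>, but \<open>?T {}\<close> counts the
    vectors of the plane.\<close>
  finally show False
    by simp
qed

end
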